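(* Let $n,m\in\mathbb{N}$, $S\subseteq\mathbb{Z}^n$, $x(0)\in S$, and let $\mathcal{U}\subseteq\mathbb{Z}^n$ be finite. Let $G=(V,E)$ be the directed graph with $V=\mathbb{Z}^n$ and $E=\{(x,y)\mid y-x\in\mathcal{U}\}$. Then the free partition control problem (FPCP) for $S$, $x(0)$, $\mathcal{U}$ and $m$ admits a solution if and only if there exist an induced subgraph $G_{\hat{S}}=(\hat{S},E_{\hat{S}})\subseteq G$ with $\hat{S}\subseteq S$ and a labeling $l:E_{\hat{S}}\to[m]$ such that the following properties hold: (C1) $x(0)\in\hat{S}$; (C2) for all $x\in\hat{S}$, $l\left(\{(x,x')\in E_{\hat{S}}\mid x'\in\hat{S}\}\right)=[m]$; (C3) if $(x,y),(x',y')\in E_{\hat{S}}$ satisfy $y-x=y'-x'$, then $l(x,y)=l(x',y')$.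
   Context: Notation: $\mathbb{N}$ is the set of strictly positive integers, $\mathbb{N}_0$ the nonnegative integers, $[m]=\{1,\ldots,m\}$. The induced subgraph $G_{\hat{S}}$ has vertex set $\hat{S}$ and edge set $E_{\hat{S}}=\{(x,y)\in E\mid x,y\in\hat{S}\}$ (loops are included if $0\in\mathcal{U}$). For a set $A$ of edges, $l(A)$ is the image of $A$ under $l$. A partition $\{U(1),\ldots,U(m)\}$ of $\mathcal{U}$ is indexed by $[m]$: the sets $U(d)$, $d\in[m]$, are nonempty, pairwise disjoint for distinct indices, and have union $\mathcal{U}$. RPCP. Given $S$, $x(0)$, $\mathcal{U}$ and a partition $\{U(1),\ldots,U(m)\}$ of $\mathcal{U}$, the restricted partition control problem (RPCP) admits a solution if there exists a function $\hat{u}:\bigcup_{i=1}^\infty [m]^i\to\mathcal{U}$ such that (i) $\hat{u}(d_1,\ldots,d_k)\in U(d_k)$ for all $k\in\mathbb{N}$ and all $d_1,\ldots,d_k\in[m]$, and (ii) for every $d:\mathbb{N}_0\to[m]$, if $x(t)$ is the solution of $x(t+1)=x(t)+u(t)$, $t\in\mathbb{N}_0$, starting at the given $x(0)$, with $u(t)=\hat{u}(d(0),\ldots,d(t))$, then $x(t)\in S$ for all $t\in\mathbb{N}_0$. FPCP. Given $S$, $x(0)$, $\mathcal{U}$ and $m$, the free partition control problem (FPCP) admits a solution if there exists a partition $\{U(1),\ldots,U(m)\}$ of $\mathcal{U}$ for which the RPCP admits a solution. *)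

theory Defs
  imports
    "HOL-Analysis.Finite_Cartesian_Product"
    "HOL-Library.Disjoint_Sets"
    "HOL-Library.FuncSet"
    "Graph_Theory.Digraph_Component"
begin

text \<open>The index set \<open>[m]\<close> is \<open>{1..m}\<close>; only the values \<open>P d\<close> with \<open>d \<in> {1..m}\<close> matter.\<close>

definition indexed_partition :: "nat \<Rightarrow> (nat \<Rightarrow> 'a set) \<Rightarrow> 'a set \<Rightarrow> bool" where
  "indexed_partition m P U \<longleftrightarrow>
     (\<forall>d\<in>{1..m}. P d \<noteq> {}) \<and> disjoint_family_on P {1..m} \<and> (\<Union>d\<in>{1..m}. P d) = U"

text \<open>
  The union of the sets \<open>[m]\<^sup>i\<close>, \<open>i \<ge> 1\<close>, is rendered as the set of nonempty lists over
  \<open>{1..m}\<close>, with \<open>(d\<^sub>1, \<dots>, d\<^sub>k)\<close> written in this order, so \<open>d\<^sub>k\<close> is the last entry.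
\<close>

definition disturbance_words :: "nat \<Rightarrow> nat list set" where
  "disturbance_words m = {ds. ds \<noteq> [] \<and> set ds \<subseteq> {1..m}}"

definition RPCP_solvable ::
  "(int ^ 'n) set \<Rightarrow> int ^ 'n \<Rightarrow> (int ^ 'n) set \<Rightarrow> nat \<Rightarrow> (nat \<Rightarrow> (int ^ 'n) set) \<Rightarrow> bool" where
  "RPCP_solvable S x0 U m P \<longleftrightarrow>
     (\<exists>u. u \<in> disturbance_words m \<rightarrow> U \<and>
        (\<forall>ds\<in>disturbance_words m. u ds \<in> P (last ds)) \<and>
        (\<forall>(d :: nat \<Rightarrow> nat) x. (\<forall>t. d t \<in> {1..m}) \<longrightarrow>
           x 0 = x0 \<longrightarrow> (\<forall>t. x (Suc t) = x t + u (map d [0..<Suc t])) \<longrightarrow>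
           (\<forall>t. x t \<in> S)))"

definition FPCP_solvable ::
  "(int ^ 'n) set \<Rightarrow> int ^ 'n \<Rightarrow> (int ^ 'n) set \<Rightarrow> nat \<Rightarrow> bool" where
  "FPCP_solvable S x0 U m \<longleftrightarrow> (\<exists>P. indexed_partition m P U \<and> RPCP_solvable S x0 U m P)"

definition translation_graph :: "(int ^ 'n) set \<Rightarrow> (int ^ 'n) pair_pre_digraph" where
  "translation_graph U = \<lparr> pverts = UNIV, parcs = {(x, y). y - x \<in> U} \<rparr>"

end

theory Submission
  imports Defs
begin

text \<open>
  If the RPCP is solved by \<open>u\<close>, the states reachable under \<open>u\<close> induce the required subgraph, with
  each edge labelled by the partition cell containing its increment. Conversely, (C3) makes the
  labeling a function of the increment; extending it arbitrarily to the remaining elements of the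
  input set gives the partition, and (C2) provides a state feedback that never leaves the
  subgraph.
\<close>

text \<open>The vertex set fixes the arcs of an induced subgraph. Conversely, the arc equation puts
  both ends of every arc in \<open>pverts H\<close>, so it already yields well-formedness of
  \<open>H\<close>.\<close>

lemma induced_subgraph_translation_graph_iff:
  "induced_subgraph (with_proj H) (with_proj (translation_graph U)) \<longleftrightarrow>
    parcs H = {(x, y). x \<in> pverts H \<and> y \<in> pverts H \<and> y - x \<in> U}" (is "?L \<longleftrightarrow> ?R")
proof
  assume ?L
  then have "parcs H = {e \<in> parcs (translation_graph U). fst e \<in> pverts H \<and> snd e \<in> pverts H}"
    by (simp add: induced_subgraph_def)
  also have "\<dots> = {(x, y). x \<in> pverts H \<and> y \<in> pverts H \<and> y - x \<in> U}"
    by (auto simp: translation_graph_def)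
  finally show ?R .
next
  assume R: ?R
  have "wf_digraph (with_proj H)" "wf_digraph (with_proj (translation_graph U))"
    by (unfold_locales; auto simp: R translation_graph_def)+
  then show ?L
    by (auto simp: induced_subgraph_def subgraph_def compatible_def R translation_graph_def)
qed

text \<open>Indexing states by finite disturbance words makes the reachable set an image over words.
  The input at step \<open>k\<close> sees the disturbances up to and including that step, hence the
  prefix of length \<open>Suc k\<close>.\<close>

definition open_loop_state :: "(int ^ 'n) \<Rightarrow> (nat list \<Rightarrow> int ^ 'n) \<Rightarrow> nat list \<Rightarrow> int ^ 'n" where
  "open_loop_state x0 u w = x0 + (\<Sum>k<length w. u (take (Suc k) w))"

lemma open_loop_state_Nil [simp]: "open_loop_state x0 u [] = x0"
  by (simp add: open_loop_state_def)

lemma open_loop_state_snoc [simp]: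
  "open_loop_state x0 u (w @ [d]) = open_loop_state x0 u w + u (w @ [d])"
  by (simp add: open_loop_state_def algebra_simps)

text \<open>Safety is assumed along infinite disturbance sequences. By causality the state after
  \<open>w\<close> depends on \<open>w\<close> alone, so any infinite continuation of
  \<open>w\<close> transfers safety to it.\<close>

lemma open_loop_state_in_safe_set:
  fixes x0 :: "int ^ 'n"
  assumes safe: "\<forall>(d :: nat \<Rightarrow> nat) x. (\<forall>t. d t \<in> {1..m}) \<longrightarrow> x 0 = x0 \<longrightarrow>
      (\<forall>t. x (Suc t) = x t + u (map d [0..<Suc t])) \<longrightarrow> (\<forall>t. x t \<in> S)"
    and "m \<ge> 1" and w: "set w \<subseteq> {1..m}"
  shows "open_loop_state x0 u w \<in> S"
proof -
  \<comment> \<open>Padding with 1 stays in \<open>{1..m}\<close> because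
    \<open>m \<ge> 1\<close>.\<close>
  define d where "d t = (if t < length w then w ! t else 1)" for t
  have d: "\<forall>t. d t \<in> {1..m}"
    using \<open>m \<ge> 1\<close> w nth_mem unfolding d_def by fastforce
  have "\<forall>t. open_loop_state x0 u (map d [0..<t]) \<in> S"
    using safe[rule_format, of d "\<lambda>t. open_loop_state x0 u (map d [0..<t])"] d by simp
  moreover have "map d [0..<length w] = w"
    by (rule nth_equalityI) (simp_all add: d_def)
  ultimately show ?thesis
    by metis
qed

lemma FPCP_solvable_imp_labeled_subgraph:
  fixes S U :: "(int ^ 'n) set"
  assumes "m \<ge> 1" and "FPCP_solvable S x0 U m"
  obtains H :: "(int ^ 'n) pair_pre_digraph" and l :: "(int ^ 'n) \<times> (int ^ 'n) \<Rightarrow> nat"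
  where "induced_subgraph (with_proj H) (with_proj (translation_graph U))"
    and "pverts H \<subseteq> S" and "l \<in> parcs H \<rightarrow> {1..m}" and "x0 \<in> pverts H"
    and "\<forall>x\<in>pverts H. l ` {(x, x') | x'. x' \<in> pverts H \<and> (x, x') \<in> parcs H} = {1..m}"
    and "\<forall>x y x' y'. (x, y) \<in> parcs H \<and> (x', y') \<in> parcs H \<and> y - x = y' - x' \<longrightarrow>
          l (x, y) = l (x', y')"
proof -
  obtain P u where P: "indexed_partition m P U"
    and uP: "\<forall>ds\<in>disturbance_words m. u ds \<in> P (last ds)"
    and uU: "u \<in> disturbance_words m \<rightarrow> U"
    and safe: "\<forall>(d :: nat \<Rightarrow> nat) x. (\<forall>t. d t \<in> {1..m}) \<longrightarrow> x 0 = x0 \<longrightarrow>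
      (\<forall>t. x (Suc t) = x t + u (map d [0..<Suc t])) \<longrightarrow> (\<forall>t. x t \<in> S)"
    using assms(2) unfolding FPCP_solvable_def RPCP_solvable_def by blast
  define R where "R = open_loop_state x0 u ` {w. set w \<subseteq> {1..m}}"
  define H where "H = \<lparr>pverts = R, parcs = {(x, y). x \<in> R \<and> y \<in> R \<and> y - x \<in> U}\<rparr>"
  \<comment> \<open>The index of the cell containing \<open>v\<close>: unique by disjointness, and
    existing when \<open>v\<close> lies in \<open>U\<close>.\<close>
  define c where "c v = (THE d. d \<in> {1..m} \<and> v \<in> P d)" for v
  have c_eq: "c v = d" if "d \<in> {1..m}" "v \<in> P d" for v d
    unfolding c_def
  proof (rule the_equality)
    show "d' = d" if "d' \<in> {1..m} \<and> v \<in> P d'" for d'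
      using P that \<open>d \<in> {1..m}\<close> \<open>v \<in> P d\<close>
      unfolding indexed_partition_def disjoint_family_on_def by blast
  qed (use that in simp)
  have c_range: "c v \<in> {1..m}" if "v \<in> U" for v
    using P that c_eq unfolding indexed_partition_def by blast
  define l :: "(int ^ 'n) \<times> (int ^ 'n) \<Rightarrow> nat" where "l = (\<lambda>(x, y). c (y - x))"
  \<comment> \<open>This is (C2). Different words may reach \<open>x\<close> and prescribe different
    inputs there; any one of them, extended by \<open>d\<close>, gives a reachable successor whose
    increment lies in \<open>P d\<close>.\<close>
  have successor: "\<exists>x'. x' \<in> R \<and> x' - x \<in> U \<and> c (x' - x) = d"
    if x: "x \<in> R" and d: "d \<in> {1..m}" for x d
  proof -
    from x obtain w where w: "set w \<subseteq> {1..m}" "x = open_loop_state x0 u w"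
      unfolding R_def by blast
    have wd: "w @ [d] \<in> disturbance_words m"
      using w(1) d unfolding disturbance_words_def by auto
    have "open_loop_state x0 u (w @ [d]) \<in> R"
      using w(1) d unfolding R_def by (intro imageI) auto
    moreover have "u (w @ [d]) \<in> U" "u (w @ [d]) \<in> P d"
      using wd uU uP by (auto dest: bspec)
    ultimately show ?thesis
      using w(2) c_eq[OF d] by (intro exI[of _ "open_loop_state x0 u (w @ [d])"]) simp
  qed
  show thesis
  proof (rule that[of H l])
    show "induced_subgraph (with_proj H) (with_proj (translation_graph U))"
      by (simp add: induced_subgraph_translation_graph_iff H_def)
    show "pverts H \<subseteq> S"
      using open_loop_state_in_safe_set[OF safe \<open>m \<ge> 1\<close>] by (simp add: H_def R_def image_subset_iff)
    show "l \<in> parcs H \<rightarrow> {1..m}"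
      using c_range unfolding H_def l_def by auto
    have "open_loop_state x0 u [] \<in> R"
      unfolding R_def by (intro imageI) simp
    then show "x0 \<in> pverts H"
      by (simp add: H_def)
    show "\<forall>x\<in>pverts H. l ` {(x, x') | x'. x' \<in> pverts H \<and> (x, x') \<in> parcs H} = {1..m}"
    proof (intro ballI equalityI subsetI)
      fix x d
      assume "x \<in> pverts H" "d \<in> l ` {(x, x') | x'. x' \<in> pverts H \<and> (x, x') \<in> parcs H}"
      then show "d \<in> {1..m}"
        using c_range unfolding H_def l_def by auto
    next
      fix x d
      assume x: "x \<in> pverts H" and "d \<in> {1..m}"
      then obtain x' where "x' \<in> R" "x' - x \<in> U" "c (x' - x) = d"
        using successor[of x d] by (auto simp: H_def)
      with x show "d \<in> l ` {(x, x') | x'. x' \<in> pverts H \<and> (x, x') \<in> parcs H}"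
        by (intro image_eqI[of _ _ "(x, x')"]) (auto simp: H_def l_def)
    qed
    \<comment> \<open>(C3) is built in, since \<open>l\<close> depends on the difference of the
      endpoints only.\<close>
    show "\<forall>x y x' y'. (x, y) \<in> parcs H \<and> (x', y') \<in> parcs H \<and> y - x = y' - x' \<longrightarrow>
          l (x, y) = l (x', y')"
      by (simp add: l_def)
  qed
qed

lemma labeled_subgraph_imp_FPCP_solvable:
  fixes S U :: "(int ^ 'n) set" and H :: "(int ^ 'n) pair_pre_digraph"
    and l :: "(int ^ 'n) \<times> (int ^ 'n) \<Rightarrow> nat"
  assumes "m \<ge> 1"
    and "induced_subgraph (with_proj H) (with_proj (translation_graph U))"
    and "pverts H \<subseteq> S" and l: "l \<in> parcs H \<rightarrow> {1..m}" and "x0 \<in> pverts H"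
    and labels: "\<forall>x\<in>pverts H. l ` {(x, x') | x'. x' \<in> pverts H \<and> (x, x') \<in> parcs H} = {1..m}"
    and l_cong: "\<forall>x y x' y'. (x, y) \<in> parcs H \<and> (x', y') \<in> parcs H \<and> y - x = y' - x' \<longrightarrow>
          l (x, y) = l (x', y')"
  shows "FPCP_solvable S x0 U m"
proof -
  have E: "parcs H = {(x, y). x \<in> pverts H \<and> y \<in> pverts H \<and> y - x \<in> U}"
    using assms(2) by (simp add: induced_subgraph_translation_graph_iff)
  \<comment> \<open>The label of an increment is read off an arbitrary edge realising it, the choice
    being harmless by (C3). Increments realised by no edge of \<open>H\<close> go to cell 1, so that
    the cells exhaust \<open>U\<close>.\<close>
  define lab where "lab v = (if \<exists>e\<in>parcs H. snd e - fst e = v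
    then l (SOME e. e \<in> parcs H \<and> snd e - fst e = v) else 1)" for v
  have lab_eq: "lab (y - x) = l (x, y)" if xy: "(x, y) \<in> parcs H" for x y
  proof -
    define e where "e = (SOME e. e \<in> parcs H \<and> snd e - fst e = y - x)"
    have "e \<in> parcs H \<and> snd e - fst e = y - x"
      unfolding e_def by (rule someI[of _ "(x, y)"]) (simp add: xy)
    then have "l (fst e, snd e) = l (x, y)"
      using l_cong xy by (metis prod.collapse)
    moreover have "lab (y - x) = l e"
      using xy unfolding lab_def e_def by force
    ultimately show ?thesis
      by simp
  qed
  have lab_range: "lab v \<in> {1..m}" for v
  proof (cases "\<exists>e\<in>parcs H. snd e - fst e = v")
    case True
    then obtain x y where "(x, y) \<in> parcs H" "v = y - x"
      by auto
    then show ?thesis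
      using lab_eq l by (auto dest: funcset_mem)
  next
    case False
    then show ?thesis
      using \<open>m \<ge> 1\<close> by (simp add: lab_def)
  qed
  define P where "P d = {v \<in> U. lab v = d}" for d
  \<comment> \<open>State feedback: (C2) offers, at each vertex and for each disturbance
    \<open>d\<close>, an outgoing edge labelled \<open>d\<close>.\<close>
  define g where "g x d = (SOME x'. (x, x') \<in> parcs H \<and> l (x, x') = d)" for x d
  have g: "(x, g x d) \<in> parcs H \<and> l (x, g x d) = d" if "x \<in> pverts H" "d \<in> {1..m}" for x d
  proof -
    have "d \<in> l ` {(x, x') | x'. x' \<in> pverts H \<and> (x, x') \<in> parcs H}"
      using labels that by blast
    then have "\<exists>x'. (x, x') \<in> parcs H \<and> l (x, x') = d"
      by blast
    then show ?thesis
      unfolding g_def by (rule someI_ex)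
  qed
  have g_verts: "g x d \<in> pverts H" and g_diff: "g x d - x \<in> P d"
    if "x \<in> pverts H" "d \<in> {1..m}" for x d
    using g[OF that] lab_eq[of x "g x d"] E unfolding P_def by auto
  have foldl_verts: "foldl g x0 ds \<in> pverts H" if "set ds \<subseteq> {1..m}" for ds
    using that by (induction ds rule: rev_induct) (auto simp: \<open>x0 \<in> pverts H\<close> intro!: g_verts)
  \<comment> \<open>The feedback turned into a function of the disturbance history: the increment of
    the closed-loop state caused by the last letter.\<close>
  define u where "u ds = foldl g x0 ds - foldl g x0 (butlast ds)" for ds
  have u_P: "u ds \<in> P (last ds)" if "ds \<in> disturbance_words m" for ds
  proof -
    from that have "ds \<noteq> []"
      by (simp add: disturbance_words_def)
    then obtain w d where ds: "ds = w @ [d]"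
      by (metis rev_exhaust)
    with that have "set w \<subseteq> {1..m}" "d \<in> {1..m}"
      unfolding disturbance_words_def by auto
    then show ?thesis
      using g_diff[OF foldl_verts] by (simp add: ds u_def)
  qed
  \<comment> \<open>Each label occurs on an edge leaving \<open>x0\<close>, so no cell is
    empty.\<close>
  have "P d \<noteq> {}" if "d \<in> {1..m}" for d
    using g_diff[OF \<open>x0 \<in> pverts H\<close> that] by blast
  moreover have "(\<Union>d\<in>{1..m}. P d) = U"
    using lab_range unfolding P_def by blast
  moreover have "disjoint_family_on P {1..m}"
    unfolding P_def disjoint_family_on_def by blast
  ultimately have "indexed_partition m P U"
    by (simp add: indexed_partition_def)
  moreover have "RPCP_solvable S x0 U m P"
    unfolding RPCP_solvable_def
  proof (intro exI[of _ u] conjI ballI allI impI)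
    show "u \<in> disturbance_words m \<rightarrow> U"
      using u_P unfolding P_def by blast
    show "u ds \<in> P (last ds)" if "ds \<in> disturbance_words m" for ds
      using u_P that .
    fix d :: "nat \<Rightarrow> nat" and x t
    assume d: "\<forall>t. d t \<in> {1..m}" and "x 0 = x0"
      and step: "\<forall>t. x (Suc t) = x t + u (map d [0..<Suc t])"
    \<comment> \<open>The increments telescope, so the trajectory is the feedback path and remains
      in \<open>pverts H\<close>.\<close>
    have "x t = foldl g x0 (map d [0..<t])"
      by (induction t) (simp_all add: \<open>x 0 = x0\<close> step u_def)
    moreover have "foldl g x0 (map d [0..<t]) \<in> pverts H"
      using d by (intro foldl_verts) auto
    ultimately show "x t \<in> S"
      using \<open>pverts H \<subseteq> S\<close> by auto
  qed
  ultimately show ?thesis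
    unfolding FPCP_solvable_def by blast
qed

theorem theorem1:
  fixes S U :: "(int ^ 'n) set" and x0 :: "int ^ 'n" and m :: nat
  assumes "m \<ge> 1" and "x0 \<in> S" and "finite U"
  shows "FPCP_solvable S x0 U m \<longleftrightarrow>
    (\<exists>(H :: (int ^ 'n) pair_pre_digraph) (l :: (int ^ 'n) \<times> (int ^ 'n) \<Rightarrow> nat).
       induced_subgraph (with_proj H) (with_proj (translation_graph U)) \<and>
       pverts H \<subseteq> S \<and>
       l \<in> parcs H \<rightarrow> {1..m} \<and>
       x0 \<in> pverts H \<and>
       (\<forall>x\<in>pverts H. l ` {(x, x') | x'. x' \<in> pverts H \<and> (x, x') \<in> parcs H} = {1..m}) \<and>
       (\<forall>x y x' y'. (x, y) \<in> parcs H \<and> (x', y') \<in> parcs H \<and> y - x = y' - x' \<longrightarrow>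
          l (x, y) = l (x', y')))"
  (is "_ \<longleftrightarrow> ?rhs")
proof
  assume "FPCP_solvable S x0 U m"
  with \<open>m \<ge> 1\<close> show ?rhs
    by (rule FPCP_solvable_imp_labeled_subgraph) (intro exI conjI)
next
  assume ?rhs
  then show "FPCP_solvable S x0 U m"
    by (elim exE conjE) (rule labeled_subgraph_imp_FPCP_solvable[OF \<open>m \<ge> 1\<close>])
qed

end
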